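(* Let $A\subseteq[n]$. If $k\geq N_{[n]\setminus A}$, then $D_{\mathcal{M}_{n,k}}$ is bounded by $$D_{\mathcal{M}_{n,k}}\leq \log\big( N_{A} / \max_{j\in A}N_j \big).$$ When all visible variables are binary, we have the tighter bound $$D_{\mathcal{M}_{n,k}} \leq \Big( n -\lfloor \log_2(k) \rfloor - \frac{k}{2^{\lfloor\log_2 (k)\rfloor}} \Big) \log(2).$$ Here $\mathcal{M}_{n,k}$ is the mixture of product distributions (naïve Bayes model) with $n$ visible variables, the $i$-th having a finite state space $\mathcal{X}_i$ of cardinality $N_i$, and one hidden variable with $k$ states.
   Context: Notation: $[n]=\{1,\dots,n\}$, $\mathcal{X}=\mathcal{X}_1\times\cdots\times\mathcal{X}_n$ with $\mathcal{X}_i$ finite and $|\mathcal{X}_i|=N_i$. For $B\subseteq[n]$, $N_B=\prod_{i\in B}N_i$ is the number of joint states of the units indexed by $B$. Binary visible variables means $N_i=2$ for all $i\in[n]$. $\Delta(\mathcal{X})$ is the set of all probability distributions on $\mathcal{X}$. For $p,q\in\Delta(\mathcal{X})$, $D(p\|q)=\sum_{x}p(x)\log\frac{p(x)}{q(x)}$ is the Kullback-Leibler divergence; the base of the logarithm is arbitrary, but the same $\log$ is used in the definition of $D$ and in the bounds. For a model $\mathcal{M}\subseteq\Delta(\mathcal{X})$, $D(p\|\mathcal{M})=\inf_{q\in\mathcal{M}}D(p\|q)$, and the maximal information divergence from $\mathcal{M}$ is $D_{\mathcal{M}}=\max_{p\in\Delta(\mathcal{X})}D(p\|\mathcal{M})$.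 A product distribution on $\mathcal{X}$ is a distribution of the form $p(x)=\prod_{i\in[n]}p_i(x_i)$ with $p_i\in\Delta(\mathcal{X}_i)$. The model $\mathcal{M}_{n,k}$ is the graphical model on a star graph, where the leaves are the $n$ visible variables and the internal node is a hidden variable with $k$ states; that is, the set of all distributions $\sum_{j=1}^k\lambda_j p^{(j)}$ with $\lambda_j\ge 0$, $\sum_j\lambda_j=1$, and each $p^{(j)}$ a product distribution on $\mathcal{X}$.
   Formalization: The binary bound is proved for k ≤ 2^(n-1) with n ≥ 1 (that is, 2k ≤ 2^n); for all other k its right-hand side is negative (e.g. −log 2 at n=1, k=2), so the bound as stated is false there because divergences are nonnegative. *)

theory Defs
  imports "HOL-Probability.Probability"
begin

definition joint_states :: "nat \<Rightarrow> (nat \<Rightarrow> 'a set) \<Rightarrow> (nat \<Rightarrow> 'a) set" where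
  "joint_states n X = (\<Pi>\<^sub>E i\<in>{1..n}. X i)"

definition num_states :: "(nat \<Rightarrow> 'a set) \<Rightarrow> nat set \<Rightarrow> nat" where
  "num_states X B = (\<Prod>i\<in>B. card (X i))"

text \<open>The maximum over the empty set is taken to be 1, the neutral value for
  cardinalities of nonempty sets.\<close>

definition max_card :: "(nat \<Rightarrow> 'a set) \<Rightarrow> nat set \<Rightarrow> nat" where
  "max_card X A = (if A = {} then 1 else Max ((\<lambda>j. card (X j)) ` A))"

definition prob_dists :: "'a set \<Rightarrow> 'a pmf set" where
  "prob_dists S = {p. set_pmf p \<subseteq> S}"

text \<open>The summands with \<open>pmf p x = 0\<close> vanish, in accordance with \<open>0 log (0 / q) = 0\<close>,
  and the divergence is infinite if \<open>p\<close> is not absolutely continuous with respect to \<open>q\<close>.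
  The parameter \<open>b\<close> is the base of the logarithm.\<close>

definition KL_div :: "real \<Rightarrow> 'a set \<Rightarrow> 'a pmf \<Rightarrow> 'a pmf \<Rightarrow> ereal" where
  "KL_div b S p q =
     (if \<exists>x\<in>S. pmf p x > 0 \<and> pmf q x = 0 then \<infinity>
      else ereal (\<Sum>x\<in>S. pmf p x * log b (pmf p x / pmf q x)))"

definition model_div :: "real \<Rightarrow> 'a set \<Rightarrow> 'a pmf \<Rightarrow> 'a pmf set \<Rightarrow> ereal" where
  "model_div b S p M = (INF q\<in>M. KL_div b S p q)"

text \<open>The supremum is taken in the extended reals; it equals the maximum whenever the latter
  is attained, which is the case for the mixture models below.\<close>

definition max_div :: "real \<Rightarrow> 'a set \<Rightarrow> 'a pmf set \<Rightarrow> ereal" where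
  "max_div b S M = (SUP p\<in>prob_dists S. model_div b S p M)"

definition product_dists :: "nat \<Rightarrow> (nat \<Rightarrow> 'a set) \<Rightarrow> (nat \<Rightarrow> 'a) pmf set" where
  "product_dists n X =
     {p \<in> prob_dists (joint_states n X).
        \<exists>m. (\<forall>i\<in>{1..n}. m i \<in> prob_dists (X i)) \<and>
            (\<forall>x\<in>joint_states n X. pmf p x = (\<Prod>i\<in>{1..n}. pmf (m i) (x i)))}"

definition mixture_model :: "nat \<Rightarrow> nat \<Rightarrow> (nat \<Rightarrow> 'a set) \<Rightarrow> (nat \<Rightarrow> 'a) pmf set" where
  "mixture_model n k X =
     {q \<in> prob_dists (joint_states n X).
        \<exists>(w :: nat \<Rightarrow> real) r.
          (\<forall>j\<in>{1..k}. w j \<ge> 0) \<and> (\<Sum>j\<in>{1..k}. w j) = 1 \<and>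
          (\<forall>j\<in>{1..k}. r j \<in> product_dists n X) \<and>
          (\<forall>x\<in>joint_states n X. pmf q x = (\<Sum>j\<in>{1..k}. w j * pmf (r j) x))}"

end

theory Submission
  imports Defs "HOL-Probability.Product_PMF"
begin

text \<open>Query the coordinates of \<open>x\<close> along a decision tree, and let \<open>F x\<close> be the set of coordinates
  that have been read when a leaf is reached. The leaves partition the states into at most \<open>k\<close>
  cylinder sets. The mixture approximating \<open>p\<close> gives each leaf its mass under \<open>p\<close> and uses, on
  that leaf, the conditional marginal of \<open>p\<close> on one further coordinate and uniform distributions
  on the remaining ones. Since a joint probability is at most a marginal one, \<open>p / q\<close> is bounded
  pointwise by the number of states of the uniform coordinates.

  The first bound reads \<open>[n] - A\<close> everywhere and keeps the largest unit of \<open>A\<close>. For the binary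
  bound with \<open>k = 2 ^ l + r\<close>, read \<open>l\<close> coordinates, and one more on the \<open>r\<close> most probable cells.\<close>

section \<open>Product distributions that dominate \<open>p\<close> on a box\<close>

lemma finite_joint_states:
  assumes "\<forall>i\<in>{1..n}. finite (X i) \<and> X i \<noteq> {}"
  shows "finite (joint_states n X)"
  using assms unfolding joint_states_def by (intro finite_PiE) auto

lemma Pi_pmf_in_product_dists:
  assumes "\<forall>i\<in>{1..n}. m i \<in> prob_dists (X i)"
  shows "Pi_pmf {1..n} undefined m \<in> product_dists n X"
proof -
  have "set_pmf (Pi_pmf {1..n} undefined m) \<subseteq> joint_states n X"
    using set_Pi_pmf_subset'[of "{1..n}" undefined m] assms
    unfolding joint_states_def prob_dists_def PiE_dflt_def
    by (fastforce simp: PiE_def extensional_def)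
  moreover have "pmf (Pi_pmf {1..n} undefined m) x = (\<Prod>i\<in>{1..n}. pmf (m i) (x i))"
    if "x \<in> joint_states n X" for x
    using that unfolding joint_states_def
    by (intro pmf_Pi') (auto simp: PiE_def extensional_def)
  ultimately show ?thesis
    using assms unfolding product_dists_def prob_dists_def by blast
qed

text \<open>Coordinate \<open>j\<close> of \<open>r\<close> carries the marginal of \<open>p\<close>
  conditioned on \<open>B\<close>, which bounds the conditional probability of each point of
  \<open>B\<close> from above. Every other coordinate is uniform on \<open>Y i\<close> and costs
  exactly a factor \<open>card (Y i)\<close>.\<close>

lemma exists_product_dist_dominating_on_box:
  fixes p :: "(nat \<Rightarrow> 'a) pmf"
  assumes fin: "\<forall>i\<in>{1..n}. finite (Y i) \<and> Y i \<noteq> {} \<and> Y i \<subseteq> X i"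
  defines "B \<equiv> joint_states n Y"
  shows "\<exists>r\<in>product_dists n X. \<forall>x\<in>B.
    pmf p x \<le> measure_pmf.prob p B * pmf r x * (\<Prod>i\<in>{1..n} - {j}. real (card (Y i)))"
\<comment> \<open>If \<open>B\<close> has no mass, conditioning on it is meaningless; the left side
  is then 0 on \<open>B\<close> and any product distribution serves.\<close>
proof (cases "set_pmf p \<inter> B = {}")
  case True
  have "Pi_pmf {1..n} undefined (\<lambda>i. pmf_of_set (Y i)) \<in> product_dists n X"
    using fin by (intro Pi_pmf_in_product_dists) (simp add: prob_dists_def)
  moreover have "pmf p x = 0" if "x \<in> B" for x
    using True that by (auto simp: set_pmf_iff)
  ultimately show ?thesis
    by (intro bexI) (auto intro!: mult_nonneg_nonneg prod_nonneg)
next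
  case False
  define marg where "marg = map_pmf (\<lambda>x. x j) (cond_pmf p B)"
  define m where "m i = (if i = j then marg else pmf_of_set (Y i))" for i
  have m: "\<forall>i\<in>{1..n}. m i \<in> prob_dists (X i)"
  proof
    fix i assume i: "i \<in> {1..n}"
    have "x i \<in> X i" if "x \<in> B" for x
      using that i fin unfolding B_def joint_states_def by (meson PiE_mem subsetD)
    then show "m i \<in> prob_dists (X i)"
      using i fin False by (auto simp: m_def marg_def prob_dists_def set_cond_pmf)
  qed
  have pos: "measure_pmf.prob p B > 0"
    using False by (metis measure_measure_pmf_not_zero measure_nonneg order_le_less)
  have dom: "pmf p x \<le> measure_pmf.prob p B * pmf (Pi_pmf {1..n} undefined m) x *
      (\<Prod>i\<in>{1..n} - {j}. real (card (Y i)))" if x: "x \<in> B" for x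
  proof -
    define C where "C = (\<Prod>i\<in>{1..n} - {j}. real (card (Y i)))"
    have C: "C > 0"
      using fin unfolding C_def by (intro prod_pos) (auto simp: card_gt_0_iff)
    have "pmf p x = measure_pmf.prob p B * pmf (cond_pmf p B) x"
      using pos x False by (simp add: pmf_cond)
    also have "pmf (cond_pmf p B) x \<le> pmf marg (x j)"
    proof -
      have "measure_pmf.prob (cond_pmf p B) {x} \<le> pmf marg (x j)"
        unfolding marg_def pmf_map by (intro measure_pmf.finite_measure_mono) auto
      then show ?thesis by (simp add: measure_pmf_single)
    qed
    finally have 1: "pmf p x \<le> measure_pmf.prob p B * pmf marg (x j)"
      by (simp add: pos)
    have u: "(\<Prod>i\<in>{1..n} - {j}. pmf (m i) (x i)) = inverse C"
    proof -
      have "(\<Prod>i\<in>{1..n} - {j}. pmf (m i) (x i)) = (\<Prod>i\<in>{1..n} - {j}. inverse (real (card (Y i))))"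
        using fin x
        by (intro prod.cong) (auto simp: m_def B_def joint_states_def PiE_iff inverse_eq_divide)
      also have "\<dots> = inverse C"
        unfolding C_def prod_inversef[symmetric] by (simp add: o_def)
      finally show ?thesis .
    qed
    have "pmf marg (x j) * inverse C \<le> (\<Prod>i\<in>{1..n}. pmf (m i) (x i))"
    \<comment> \<open>An index \<open>j\<close> outside \<open>{1..n}\<close> is allowed: every
      coordinate is then uniform, and \<open>pmf marg (x j)\<close> is simply bounded by 1.\<close>
    proof (cases "j \<in> {1..n}")
      case True
      then have "(\<Prod>i\<in>{1..n}. pmf (m i) (x i)) = pmf marg (x j) * inverse C"
        using prod.remove[of "{1..n}" j "\<lambda>i. pmf (m i) (x i)"] unfolding u by (simp add: m_def)
      then show ?thesis by simp
    next
      case False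
      then show ?thesis
        using u C by (simp add: mult_left_le_one_le pmf_le_1)
    qed
    also have "\<dots> = pmf (Pi_pmf {1..n} undefined m) x"
      using x unfolding B_def joint_states_def
      by (intro pmf_Pi'[symmetric]) (auto simp: PiE_def extensional_def)
    finally have "pmf marg (x j) \<le> pmf (Pi_pmf {1..n} undefined m) x * C"
      using C by (simp add: field_simps)
    with 1 pos show ?thesis
      unfolding C_def[symmetric]
      by (smt (verit, best) mult.assoc mult_left_mono)
  qed
  show ?thesis
    using dom Pi_pmf_in_product_dists[OF m] by blast
qed

section \<open>Mixtures over the leaves of a decision tree\<close>

text \<open>Each fibre is weighted by its mass under \<open>p\<close>. The summand belonging to the
  fibre of \<open>x\<close> already yields the bound at \<open>x\<close>, since all other summands
  are nonnegative.\<close>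

lemma mixture_dominating_on_fibres:
  fixes f :: "(nat \<Rightarrow> 'a) \<Rightarrow> 'c"
  assumes fin: "finite S" and S: "S = joint_states n X"
    and p: "p \<in> prob_dists S"
    and card: "card (f ` S) \<le> k"
    and r: "\<And>c. c \<in> f ` S \<Longrightarrow> \<exists>r\<in>product_dists n X. \<forall>x\<in>S. f x = c \<longrightarrow>
      pmf p x \<le> measure_pmf.prob p {y\<in>S. f y = c} * pmf r x * K x"
    and K: "\<And>x. x \<in> S \<Longrightarrow> K x > 0"
  shows "\<exists>q\<in>mixture_model n k X. \<forall>x\<in>S. pmf p x \<le> pmf q x * K x"
proof -
  have "\<forall>c\<in>f ` S. \<exists>r. r \<in> product_dists n X \<and> (\<forall>x\<in>S. f x = c \<longrightarrow>
      pmf p x \<le> measure_pmf.prob p {y\<in>S. f y = c} * pmf r x * K x)"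
    using r by blast
  from bchoice[OF this] obtain R where R: "\<And>c. c \<in> f ` S \<Longrightarrow> R c \<in> product_dists n X"
    and Rdom: "\<And>x. x \<in> S \<Longrightarrow>
      pmf p x \<le> measure_pmf.prob p {y\<in>S. f y = f x} * pmf (R (f x)) x * K x"
    by blast
  have sp: "set_pmf p \<subseteq> S" using p by (simp add: prob_dists_def)
  then obtain x0 where x0: "x0 \<in> S" using set_pmf_not_empty[of p] by blast
  \<comment> \<open>The model indexes its components by \<open>{1..k}\<close>, so \<open>g\<close>
    numbers the fibres injectively. Surplus indices get weight 0 under \<open>W\<close>; the
    component at \<open>f x0\<close> only makes \<open>R'\<close> total.\<close>
  obtain g where g: "g ` (f ` S) \<subseteq> {1..k}" "inj_on g (f ` S)"
    using card_le_inj[OF finite_imageI[OF fin], of "{1..k}" f] card by auto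
  define h where "h = inv_into (f ` S) g"
  define R' where "R' j = (if j \<in> g ` f ` S then R (h j) else R (f x0))" for j
  have R': "R' j \<in> product_dists n X" for j
    using R x0 by (auto simp: R'_def h_def inv_into_into)
  define W where "W = map_pmf (g \<circ> f) p"
  define q where "q = bind_pmf W R'"
  have sW: "set_pmf W \<subseteq> {1..k}"
    using sp g(1) by (auto simp: W_def)
  have q_eq: "pmf q x = (\<Sum>j\<in>{1..k}. pmf W j * pmf (R' j) x)" for x
    unfolding q_def pmf_bind
    by (subst integral_measure_pmf_real[of "{1..k}"]) (use sW in \<open>auto simp: mult.commute\<close>)
  have "q \<in> mixture_model n k X"
  proof -
    have "set_pmf q \<subseteq> S"
    proof
      fix x assume "x \<in> set_pmf q"
      then obtain j where "x \<in> set_pmf (R' j)" by (auto simp: q_def)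
      then show "x \<in> S" using R'[of j] by (auto simp: product_dists_def prob_dists_def S)
    qed
    moreover have "(\<Sum>j\<in>{1..k}. pmf W j) = 1"
      using sW by (intro sum_pmf_eq_1) auto
    ultimately show ?thesis
      unfolding mixture_model_def prob_dists_def S
      by (intro CollectI conjI exI[of _ "pmf W"] exI[of _ R']) (auto simp: R' q_eq)
  qed
  moreover have "pmf p x \<le> pmf q x * K x" if x: "x \<in> S" for x
  proof -
    let ?j = "g (f x)"
    have "measure_pmf.prob p {y\<in>S. f y = f x} \<le> pmf W ?j"
      unfolding W_def pmf_map by (intro measure_pmf.finite_measure_mono) auto
    moreover have "R' ?j = R (f x)"
      using x g(2) by (simp add: R'_def h_def)
    moreover have "pmf W ?j * pmf (R' ?j) x \<le> pmf q x"
      unfolding q_eq using g(1) x by (intro member_le_sum) (blast, simp_all)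
    ultimately have "measure_pmf.prob p {y\<in>S. f y = f x} * pmf (R (f x)) x \<le> pmf q x"
      by (metis mult_right_mono order_trans pmf_nonneg)
    then show ?thesis
      using Rdom[OF x] K[OF x] by (smt (verit) mult_right_mono)
  qed
  ultimately show ?thesis by blast
qed

text \<open>The hypothesis \<open>stop\<close> is the analogue of the stopping time property: whether exactly
  the coordinates \<open>F x\<close> are read is decided by their values.\<close>

lemma mixture_dominating_decision_tree:
  fixes F :: "(nat \<Rightarrow> 'a) \<Rightarrow> nat set" and X :: "nat \<Rightarrow> 'a set" and n :: nat
  defines "S \<equiv> joint_states n X"
  assumes X: "\<forall>i\<in>{1..n}. finite (X i) \<and> X i \<noteq> {}"
    and p: "p \<in> prob_dists S"
    and F: "\<And>x. x \<in> S \<Longrightarrow> F x \<subseteq> {1..n}"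
    and stop: "\<And>x y. x \<in> S \<Longrightarrow> y \<in> S \<Longrightarrow> restrict y (F x) = restrict x (F x) \<Longrightarrow> F y = F x"
    and leaves: "card ((\<lambda>x. (F x, restrict x (F x))) ` S) \<le> k"
  shows "\<exists>q\<in>mixture_model n k X. \<forall>x\<in>S.
    pmf p x \<le> pmf q x * real (num_states X ({1..n} - F x - {j (F x)}))"
proof (rule mixture_dominating_on_fibres[where f = "\<lambda>x. (F x, restrict x (F x))" and S = S])
  show "finite S" using finite_joint_states[OF X] by (simp add: S_def)
  show "S = joint_states n X" by (simp add: S_def)
  show "p \<in> prob_dists S" by (rule p)
  show "card ((\<lambda>x. (F x, restrict x (F x))) ` S) \<le> k" by (rule leaves)
  show "real (num_states X ({1..n} - F x - {j (F x)})) > 0" for x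
    using X unfolding num_states_def of_nat_prod by (intro prod_pos) (auto simp: card_gt_0_iff)
next
  fix c assume "c \<in> (\<lambda>x. (F x, restrict x (F x))) ` S"
  then obtain z where z: "z \<in> S" and c: "c = (F z, restrict z (F z))" by blast
  \<comment> \<open>The cylinder of the leaf reached by \<open>z\<close>: coordinates that were read
    are frozen, all others are free.\<close>
  define Y where "Y i = (if i \<in> F z then {z i} else X i)" for i
  have zX: "z i \<in> X i" if "i \<in> {1..n}" for i
    using z that by (auto simp: S_def joint_states_def)
  have box: "{y \<in> S. (F y, restrict y (F y)) = c} = joint_states n Y"
  proof (intro set_eqI iffI)
    fix y assume "y \<in> {y \<in> S. (F y, restrict y (F y)) = c}"
    then have y: "y \<in> S" and "restrict y (F z) = restrict z (F z)" by (auto simp: c)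
    then have "y i = z i" if "i \<in> F z" for i by (metis restrict_apply' that)
    with y show "y \<in> joint_states n Y"
      by (auto simp: S_def joint_states_def PiE_iff Y_def)
  next
    fix y assume y: "y \<in> joint_states n Y"
    have eq: "y i = z i" if "i \<in> F z" for i
    proof -
      have "y i \<in> Y i" using y F[OF z] that by (auto simp: joint_states_def)
      then show ?thesis using that by (simp add: Y_def)
    qed
    have yS: "y \<in> S"
      using y zX by (fastforce simp: S_def joint_states_def PiE_iff Y_def split: if_splits)
    \<comment> \<open>Here \<open>stop\<close> enters: a point that agrees with \<open>z\<close> on
      \<open>F z\<close> reaches the same leaf, so the fibre is the whole cylinder.\<close>
    have "restrict y (F z) = restrict z (F z)" using eq by (rule restrict_ext)
    with stop[OF z yS] yS show "y \<in> {y \<in> S. (F y, restrict y (F y)) = c}" by (simp add: c)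
  qed
  \<comment> \<open>Frozen coordinates range over singletons and contribute the factor 1.\<close>
  have cardY: "(\<Prod>i\<in>{1..n} - {j (F z)}. real (card (Y i)))
      = real (num_states X ({1..n} - F z - {j (F z)}))"
    unfolding num_states_def of_nat_prod
    by (rule prod.mono_neutral_cong_right) (auto simp: Y_def)
  have "\<forall>i\<in>{1..n}. finite (Y i) \<and> Y i \<noteq> {} \<and> Y i \<subseteq> X i"
    using X zX by (auto simp: Y_def)
  \<comment> \<open>The marginal coordinate depends only on the set that was read, so it is the same
    throughout the leaf.\<close>
  from exists_product_dist_dominating_on_box[OF this, of p "j (F z)"]
  obtain r where r: "r \<in> product_dists n X" and "\<forall>x\<in>joint_states n Y. pmf p x \<le>
      measure_pmf.prob p (joint_states n Y) * pmf r x *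
        real (num_states X ({1..n} - F z - {j (F z)}))"
    unfolding cardY by blast
  then have "\<forall>x\<in>S. (F x, restrict x (F x)) = c \<longrightarrow> pmf p x \<le>
      measure_pmf.prob p {y \<in> S. (F y, restrict y (F y)) = c} * pmf r x *
        real (num_states X ({1..n} - F x - {j (F x)}))"
    unfolding box[symmetric] by (auto simp: c)
  with r show "\<exists>r\<in>product_dists n X. \<forall>x\<in>S. (F x, restrict x (F x)) = c \<longrightarrow> pmf p x \<le>
      measure_pmf.prob p {y \<in> S. (F y, restrict y (F y)) = c} * pmf r x *
        real (num_states X ({1..n} - F x - {j (F x)}))" by blast
qed

section \<open>From domination to divergence, and an averaging argument\<close>

text \<open>Where \<open>p\<close> is positive, the domination gives \<open>p / q \<le> K\<close>,
  and the logarithm is increasing. It also forces \<open>q\<close> to be positive there, which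
  excludes the infinite case of \<open>KL_div\<close>. The factor \<open>K\<close> may vary with the
  point, as the binary bound requires.\<close>

lemma KL_div_le_of_dominated:
  assumes b: "b > 1" and fin: "finite S"
    and K: "\<And>x. x \<in> S \<Longrightarrow> K x > 0" and dom: "\<And>x. x \<in> S \<Longrightarrow> pmf p x \<le> pmf q x * K x"
  shows "KL_div b S p q \<le> ereal (\<Sum>x\<in>S. pmf p x * log b (K x))"
proof -
  have ac: "pmf q x > 0" if "x \<in> S" "pmf p x > 0" for x
    using dom[of x] that by (cases "pmf q x = 0") (auto simp: pmf_pos)
  have "pmf p x * log b (pmf p x / pmf q x) \<le> pmf p x * log b (K x)" if x: "x \<in> S" for x
  proof (cases "pmf p x = 0")
    case False
    then have pp: "pmf p x > 0" by (simp add: pmf_pos)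
    with ac x have "pmf q x > 0" by blast
    then have "pmf p x / pmf q x \<le> K x" using dom[OF x] by (simp add: field_simps)
    then show ?thesis
      using b K[OF x] pp \<open>pmf q x > 0\<close> by (intro mult_left_mono) auto
  qed simp
  then have "(\<Sum>x\<in>S. pmf p x * log b (pmf p x / pmf q x)) \<le> (\<Sum>x\<in>S. pmf p x * log b (K x))"
    by (rule sum_mono)
  moreover have "\<not> (\<exists>x\<in>S. pmf p x > 0 \<and> pmf q x = 0)" using ac by fastforce
  ultimately show ?thesis by (simp add: KL_div_def)
qed

lemma max_div_le:
  assumes "\<And>p. p \<in> prob_dists S \<Longrightarrow> \<exists>q\<in>M. KL_div b S p q \<le> C"
  shows "max_div b S M \<le> C"
  unfolding max_div_def model_div_def by (rule SUP_least) (meson assms INF_lower2)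

text \<open>The \<open>r\<close> largest values have an average no smaller than that of all values.
  The induction discards a smallest element until \<open>r\<close> of them remain.\<close>

lemma exists_heavy_subset:
  fixes f :: "'a \<Rightarrow> real"
  assumes "finite P" "r \<le> card P"
  shows "\<exists>T\<subseteq>P. card T = r \<and> real r * sum f P \<le> real (card P) * sum f T"
  using assms
proof (induction "card P" arbitrary: P)
  case 0
  then show ?case by auto
next
  case (Suc N)
  show ?case
  proof (cases "r = Suc N")
    case True
    with Suc show ?thesis by (intro exI[of _ P]) auto
  next
    case False
    have ne: "P \<noteq> {}" using Suc.hyps by auto
    obtain m where m: "m \<in> P" and min: "\<And>a. a \<in> P \<Longrightarrow> f m \<le> f a"
      using ex_min_if_finite[of "f ` P"] Suc.prems ne
      by (metis arg_min_if_finite(1) arg_min_least)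
    let ?Q = "P - {m}"
    have cQ: "card ?Q = N" using Suc m by simp
    have "r \<le> card ?Q" using Suc False cQ by simp
    then obtain T where T: "T \<subseteq> ?Q" "card T = r" "real r * sum f ?Q \<le> real N * sum f T"
      using Suc.hyps(1)[of ?Q] cQ Suc.prems by auto
    \<comment> \<open>The discarded value is minimal, so \<open>r\<close> copies of it are at most
      the sum over \<open>T\<close>; this pays for the step from \<open>N\<close> to
      \<open>Suc N\<close>.\<close>
    have "real r * f m = (\<Sum>a\<in>T. f m)" using T by simp
    also have "\<dots> \<le> sum f T" using T min by (intro sum_mono) auto
    finally have "real r * f m \<le> sum f T" .
    moreover have "sum f P = f m + sum f ?Q" using Suc.prems m by (simp add: sum.remove)
    ultimately have "real r * sum f P \<le> real (card P) * sum f T"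
      using T(3) Suc.hyps(2)[symmetric] by (simp add: algebra_simps)
    with T show ?thesis by blast
  qed
qed

section \<open>The bound for arbitrary finite state spaces\<close>

text \<open>The tree that always reads \<open>{1..n} - A\<close> has at most one leaf for each joint
  state of those units. Its factor is the same at every point, so averaging under \<open>p\<close>
  returns the logarithm of that factor.\<close>

lemma max_div_mixture_model_le:
  fixes X :: "nat \<Rightarrow> 'a set"
  assumes b: "b > 1" and X: "\<forall>i\<in>{1..n}. finite (X i) \<and> X i \<noteq> {}"
    and A: "A \<subseteq> {1..n}" and k: "num_states X ({1..n} - A) \<le> k"
  shows "max_div b (joint_states n X) (mixture_model n k X)
    \<le> ereal (log b (real (num_states X A) / real (max_card X A)))"
proof (rule max_div_le)
  fix p assume p: "p \<in> prob_dists (joint_states n X)"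
  define S where "S = joint_states n X"
  define B where "B = {1..n} - A"
  have finS: "finite S" unfolding S_def by (rule finite_joint_states[OF X])
  have finA: "finite A" using A finite_subset by blast
  have cpos: "card (X i) > 0" if "i \<in> A" for i
    using that A X by (auto simp: card_gt_0_iff)
  \<comment> \<open>A largest unit of \<open>A\<close> takes the marginal. For empty
    \<open>A\<close> any \<open>j\<close> works, because \<open>max_card\<close> is then 1.\<close>
  obtain j where j: "real (num_states X (A - {j})) = real (num_states X A) / real (max_card X A)"
  proof (cases "A = {}")
    case True
    then show ?thesis using that by (simp add: num_states_def max_card_def)
  next
    case False
    then have "Max ((\<lambda>j. card (X j)) ` A) \<in> (\<lambda>j. card (X j)) ` A"
      using finA by (intro Max_in) auto
    then obtain j where "j \<in> A" "max_card X A = card (X j)"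
      using False by (auto simp: max_card_def)
    then show ?thesis
      using that[of j] finA cpos[of j] by (simp add: num_states_def prod.remove)
  qed
  have "restrict x B \<in> (\<Pi>\<^sub>E i\<in>B. X i)" if "x \<in> S" for x
  proof (rule restrict_PiE_iff[THEN iffD2], rule ballI)
    fix i assume "i \<in> B"
    then have "i \<in> {1..n}" by (simp add: B_def)
    with that show "x i \<in> X i" unfolding S_def joint_states_def by (rule PiE_mem)
  qed
  then have "(\<lambda>x. (B, restrict x B)) ` S \<subseteq> {B} \<times> (\<Pi>\<^sub>E i\<in>B. X i)" by blast
  moreover have "finite ({B} \<times> (\<Pi>\<^sub>E i\<in>B. X i))"
    using X by (auto intro!: finite_PiE simp: B_def)
  ultimately have "card ((\<lambda>x. (B, restrict x B)) ` S) \<le> card ({B} \<times> (\<Pi>\<^sub>E i\<in>B. X i))"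
    by (intro card_mono)
  also have "\<dots> = num_states X B"
    by (simp add: card_cartesian_product card_PiE B_def num_states_def)
  also have "\<dots> \<le> k" using k by (simp add: B_def)
  finally have "card ((\<lambda>x. (B, restrict x B)) ` S) \<le> k" .
  then have "\<exists>q\<in>mixture_model n k X. \<forall>x\<in>S.
      pmf p x \<le> pmf q x * real (num_states X ({1..n} - B - {j}))"
    unfolding S_def
    by (intro mixture_dominating_decision_tree[OF X p, where F = "\<lambda>_. B" and j = "\<lambda>_. j"])
      (auto simp: B_def)
  then obtain q where q: "q \<in> mixture_model n k X"
    and "\<forall>x\<in>S. pmf p x \<le> pmf q x * real (num_states X ({1..n} - B - {j}))"
    by blast
  moreover have "{1..n} - B = A" using A by (auto simp: B_def)
  ultimately have dom: "\<forall>x\<in>S. pmf p x \<le> pmf q x * real (num_states X (A - {j}))" by simp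
  have "num_states X (A - {j}) > 0"
    unfolding num_states_def using cpos by (intro prod_pos) auto
  then have "KL_div b S p q \<le> ereal (\<Sum>x\<in>S. pmf p x * log b (real (num_states X (A - {j}))))"
    using b finS dom by (intro KL_div_le_of_dominated) simp_all
  also have "\<dots> = ereal (log b (real (num_states X A) / real (max_card X A)))"
    using sum_pmf_eq_1[OF finS, of p] p
    unfolding j sum_distrib_right[symmetric] by (simp add: S_def prob_dists_def)
  finally show "\<exists>q\<in>mixture_model n k X. KL_div b (joint_states n X) p q
      \<le> ereal (log b (real (num_states X A) / real (max_card X A)))"
    using q by (auto simp: S_def)
qed

section \<open>The bound for binary units\<close>

text \<open>If \<open>D\<close> is the union of the cells that are split, the mean base-2 logarithm
  of the factor is \<open>n - l - 1 - p(D)\<close>. Splitting \<open>r\<close> cells of at least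
  average mean mass gives \<open>p(D) \<ge> r / 2^l\<close>, and
  \<open>k / 2^l = 1 + r / 2^l\<close>.\<close>

lemma max_div_binary_mixture_model_le:
  fixes X :: "nat \<Rightarrow> 'a set"
  assumes b: "b > 1" and two: "\<forall>i\<in>{1..n}. card (X i) = 2"
    and k: "k = 2 ^ l + r" and r: "r < 2 ^ l" and kn: "2 * k \<le> 2 ^ n"
  shows "max_div b (joint_states n X) (mixture_model n k X)
    \<le> ereal ((real n - real l - real k / 2 ^ l) * log b 2)"
proof (rule max_div_le)
  fix p assume p: "p \<in> prob_dists (joint_states n X)"
  define S where "S = joint_states n X"
  have X: "\<forall>i\<in>{1..n}. finite (X i) \<and> X i \<noteq> {}"
    using two by (metis card.empty card.infinite zero_neq_numeral)
  have finS: "finite S" unfolding S_def by (rule finite_joint_states[OF X])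
  have pS: "set_pmf p \<subseteq> S" using p by (simp add: prob_dists_def S_def)
  \<comment> \<open>The hypothesis \<open>kn\<close> leaves a coordinate for the marginal after
    \<open>l\<close> have been read, and also after one more has been read if
    \<open>r > 0\<close>.\<close>
  have ln: "l + 1 \<le> n"
  proof -
    have "(2::nat) ^ (l + 1) \<le> 2 ^ n" using k kn by simp
    then show ?thesis by (rule power_le_imp_le_exp[rotated]) simp
  qed
  have ln2: "l + 2 \<le> n" if "r > 0"
  proof -
    have "(2::nat) ^ (l + 1) < 2 ^ n" using k kn that by simp
    then have "l + 1 < n" by (rule power_less_imp_less_exp[rotated]) simp
    then show ?thesis by simp
  qed
  define P where "P = (\<Pi>\<^sub>E i\<in>{1..l}. X i)"
  have finP: "finite P"
    unfolding P_def using X ln by (intro finite_PiE) auto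
  have cardP: "card P = 2 ^ l"
  proof -
    have "card P = (\<Prod>i\<in>{1..l}. card (X i))" unfolding P_def by (simp add: card_PiE)
    also have "\<dots> = (\<Prod>i\<in>{1..l}. 2)" using two ln by (intro prod.cong) auto
    finally show ?thesis by simp
  qed
  have SP: "restrict x {1..l} \<in> P" if "x \<in> S" for x
    using that ln by (auto simp: S_def joint_states_def P_def)
  define pl where "pl = map_pmf (\<lambda>x. restrict x {1..l}) p"
  have plP: "sum (pmf pl) P = 1"
    using pS SP finP by (intro sum_pmf_eq_1) (auto simp: pl_def)
  obtain T where T: "T \<subseteq> P" "card T = r" "real r * sum (pmf pl) P \<le> real (card P) * sum (pmf pl) T"
    using exists_heavy_subset[OF finP, of r "pmf pl"] r cardP by auto
  have finT: "finite T" using T(1) finP finite_subset by blast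
  \<comment> \<open>The event that the extra coordinate is read.\<close>
  define D where "D = {x\<in>S. restrict x {1..l} \<in> T}"
  have "sum (pmf pl) T = measure_pmf.prob pl T"
    by (simp add: measure_measure_pmf_finite finT)
  also have "\<dots> = measure_pmf.prob p D"
    unfolding pl_def measure_map_pmf D_def using pS by (intro measure_prob_cong_0) (auto simp: set_pmf_iff)
  also have "\<dots> = sum (pmf p) D"
    using finS by (intro measure_measure_pmf_finite) (simp add: D_def)
  finally have heavy: "real r / 2 ^ l \<le> sum (pmf p) D"
    using T(3) plP cardP by (simp add: field_simps)

  define F where "F x = (if restrict x {1..l} \<in> T then {1..Suc l} else {1..l})" for x :: "nat \<Rightarrow> 'a"
  have Tr: "r > 0" if "x \<in> T" for x
    using that T(2) finT card_gt_0_iff by blast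
  have Fn: "F x \<subseteq> {1..n}" for x
    using ln by (auto simp: F_def)
  have stop: "F y = F x" if "restrict y (F x) = restrict x (F x)" for x y
  proof -
    \<comment> \<open>Both cases of \<open>F\<close> read \<open>{1..l}\<close>, and the values
      there alone decide which case applies.\<close>
    have "{1..l} \<subseteq> F x" by (auto simp: F_def)
    then have "restrict y {1..l} = restrict x {1..l}"
      using that by (metis inf.absorb_iff2 restrict_restrict)
    then show ?thesis by (simp add: F_def)
  qed
  let ?L = "(\<lambda>x. (F x, restrict x (F x))) ` S"
  \<comment> \<open>The \<open>2^l - r\<close> unsplit cells give one leaf each and the
    \<open>r\<close> split cells at most two each, so \<open>2^l + r = k\<close> components
    suffice.\<close>
  let ?U = "({{1..l}} \<times> (P - T)) \<union> (\<lambda>(c, a). ({1..Suc l}, c(Suc l := a))) ` (T \<times> X (Suc l))"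
  have "?L \<subseteq> ?U"
  proof
    fix c assume "c \<in> ?L"
    then obtain x where x: "x \<in> S" and c: "c = (F x, restrict x (F x))" by blast
    show "c \<in> ?U"
    proof (cases "restrict x {1..l} \<in> T")
      case True
      have "restrict x {1..Suc l} = (restrict x {1..l})(Suc l := x (Suc l))"
        by (auto simp: restrict_def fun_eq_iff)
      moreover have "x (Suc l) \<in> X (Suc l)"
        using x ln by (auto simp: S_def joint_states_def)
      ultimately show ?thesis
        using True by (auto simp: c F_def intro!: image_eqI[of _ _ "(restrict x {1..l}, x (Suc l))"])
    qed (use x SP in \<open>auto simp: c F_def\<close>)
  qed
  moreover have "finite ?U" using finP finT X ln by auto
  ultimately have "card ?L \<le> card ?U" by (rule card_mono[rotated])
  also have "\<dots> \<le> card ({{1..l}} \<times> (P - T)) +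
      card ((\<lambda>(c, a). ({1..Suc l}, c(Suc l := a))) ` (T \<times> X (Suc l)))"
    by (rule card_Un_le)
  also have "\<dots> \<le> card ({{1..l}} \<times> (P - T)) + card (T \<times> X (Suc l))"
    using finT X ln by (intro add_left_mono card_image_le) auto
  also have "\<dots> = (2 ^ l - r) + r * 2"
    using T finT cardP two ln by (simp add: card_cartesian_product card_Diff_subset)
  also have "\<dots> = k" using k r by simp
  finally have leaves: "card ?L \<le> k" .

  \<comment> \<open>Since \<open>F x\<close> is an initial segment, \<open>Suc (card (F x))\<close>
    is the first unread coordinate; it takes the marginal.\<close>
  let ?K = "\<lambda>x. real (num_states X ({1..n} - F x - {Suc (card (F x))}))"
  obtain q where q: "q \<in> mixture_model n k X" and dom: "\<forall>x\<in>S. pmf p x \<le> pmf q x * ?K x"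
    using mixture_dominating_decision_tree[OF X p, where F = F and k = k and j = "\<lambda>I. Suc (card I)"]
      Fn stop leaves unfolding S_def by blast
  have K: "?K x = 2 ^ (n - l - (if x \<in> D then 2 else 1))" if x: "x \<in> S" for x
  proof -
    have "{1..n} - F x - {Suc (card (F x))} = {l + (if x \<in> D then 2 else 1)<..n}"
      using x by (auto simp: D_def F_def)
    then have "?K x = (\<Prod>i\<in>{l + (if x \<in> D then 2 else 1)<..n}. 2)"
      unfolding num_states_def of_nat_prod using two by (intro prod.cong) auto
    then show ?thesis by (simp add: diff_diff_left)
  qed
  have logK: "log b (?K x) = (real n - real l - 1) * log b 2 - (if x \<in> D then log b 2 else 0)"
    if x: "x \<in> S" for x
  proof (cases "x \<in> D")
    case True
    \<comment> \<open>The exponent in \<open>K\<close> is a truncated subtraction, so points of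
      \<open>D\<close> need this inequality; such a point makes \<open>T\<close> nonempty and hence
      \<open>r > 0\<close>.\<close>
    then have "l + 2 \<le> n" using ln2 Tr by (auto simp: D_def)
    then show ?thesis
      unfolding K[OF x] using True b by (simp add: log_nat_power of_nat_diff algebra_simps)
  next
    case False
    then show ?thesis
      unfolding K[OF x] using ln b by (simp add: log_nat_power of_nat_diff algebra_simps)
  qed
  have "KL_div b S p q \<le> ereal (\<Sum>x\<in>S. pmf p x * log b (?K x))"
    using b finS dom K by (intro KL_div_le_of_dominated) auto
  also have "(\<Sum>x\<in>S. pmf p x * log b (?K x))
      = (\<Sum>x\<in>S. pmf p x * ((real n - real l - 1) * log b 2) - (if x \<in> D then pmf p x * log b 2 else 0))"
    by (intro sum.cong refl) (simp only: logK right_diff_distrib if_distrib[of "(*) _"] mult_zero_right)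
  also have "\<dots> = (\<Sum>x\<in>S. pmf p x) * ((real n - real l - 1) * log b 2) - (\<Sum>x\<in>D. pmf p x * log b 2)"
  proof -
    have "S \<inter> D = D" by (auto simp: D_def)
    then show ?thesis
      using finS by (simp add: sum_subtractf sum_distrib_right sum.inter_restrict[symmetric])
  qed
  also have "\<dots> = (real n - real l - 1 - sum (pmf p) D) * log b 2"
    using sum_pmf_eq_1[OF finS pS] by (simp add: sum_distrib_right[symmetric] algebra_simps)
  also have "ereal \<dots> \<le> ereal ((real n - real l - real k / 2 ^ l) * log b 2)"
  proof -
    have "real k / 2 ^ l = 1 + real r / 2 ^ l" by (simp add: k add_divide_distrib)
    then show ?thesis using heavy b by (intro ereal_less_eq(3)[THEN iffD2] mult_right_mono) auto
  qed
  finally show "\<exists>q\<in>mixture_model n k X. KL_div b (joint_states n X) p q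
      \<le> ereal ((real n - real l - real k / 2 ^ l) * log b 2)"
    using q by (auto simp: S_def)
qed

theorem theorem1:
  fixes n k :: nat and X :: "nat \<Rightarrow> 'a set" and b :: real
  assumes "b > 1"
    and "k \<ge> 1"
    and "\<forall>i\<in>{1..n}. finite (X i) \<and> X i \<noteq> {}"
  shows "(\<forall>A. A \<subseteq> {1..n} \<and> k \<ge> num_states X ({1..n} - A) \<longrightarrow>
            max_div b (joint_states n X) (mixture_model n k X)
              \<le> ereal (log b (real (num_states X A) / real (max_card X A))))
       \<and> ((\<forall>i\<in>{1..n}. card (X i) = 2) \<and> 2 * k \<le> 2 ^ n \<longrightarrow>
            max_div b (joint_states n X) (mixture_model n k X)
              \<le> ereal ((real n - of_int \<lfloor>log 2 (real k)\<rfloor>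
                        - real k / 2 powi \<lfloor>log 2 (real k)\<rfloor>) * log b 2))"
proof (intro conjI allI impI; elim conjE)
  fix A assume "A \<subseteq> {1..n}" "k \<ge> num_states X ({1..n} - A)"
  then show "max_div b (joint_states n X) (mixture_model n k X)
      \<le> ereal (log b (real (num_states X A) / real (max_card X A)))"
    by (rule max_div_mixture_model_le[OF assms(1,3)])
next
  assume two: "\<forall>i\<in>{1..n}. card (X i) = 2" and kn: "2 * k \<le> 2 ^ n"
  \<comment> \<open>\<open>2^l\<close> is the largest power of two not exceeding \<open>k\<close>;
    the remainder \<open>k - 2^l\<close> is the number of cells to split.\<close>
  obtain l where l: "2 ^ l \<le> k" "k < 2 ^ (l + 1)"
    using ex_power_ivl1[of 2 k] assms(2) by auto
  then have fl: "\<lfloor>log 2 (real k)\<rfloor> = int l"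
    using floor_log_nat_eq_powr_iff[of 2 k l] assms(2) by simp
  have "k = 2 ^ l + (k - 2 ^ l)" "k - 2 ^ l < 2 ^ l" using l by auto
  from max_div_binary_mixture_model_le[OF assms(1) two this kn]
  show "max_div b (joint_states n X) (mixture_model n k X)
      \<le> ereal ((real n - of_int \<lfloor>log 2 (real k)\<rfloor>
                - real k / 2 powi \<lfloor>log 2 (real k)\<rfloor>) * log b 2)"
    by (simp add: fl)
qed

end
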